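(* For every $\delta\in(0,1)$ there is a constant $C=C(\delta)>0$ such that the following holds. Let $N\ge1$ and $k\ge1$ be integers. Then for every integer $m\ge\exp(CN^{1/3})$ there is an algorithm (an estimator depending only on $k,N,m$) such that for every choice of distinct $\ell_1,\dots,\ell_k\in\{1,2,\dots,N\}$, when given $m$ independent samples from the uniform mixture $\mathcal{M}=\frac1k\sum_{i=1}^k\chi^2(\ell_i)$, it outputs exactly the set $\{\ell_1,\dots,\ell_k\}$ with probability at least $1-\delta$.
   Context: $\chi^2(\ell)$ is the chi-squared distribution with $\ell$ degrees of freedom, with density $\frac{x^{\ell/2-1}e^{-x/2}}{2^{\ell/2}\Gamma(\ell/2)}$ on $x>0$. The mixture $\frac1k\sum_i f_i$ is the distribution whose density is the average of the densities of its components. *)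

theory Defs
  imports "HOL-Probability.Probability"
begin

definition chi_square_density :: "nat \<Rightarrow> real \<Rightarrow> real" where
  "chi_square_density l x =
     (if x > 0
      then x powr (real l / 2 - 1) * exp (- x / 2) / (2 powr (real l / 2) * Gamma (real l / 2))
      else 0)"

definition chi_square_mixture :: "nat \<Rightarrow> (nat \<Rightarrow> nat) \<Rightarrow> real measure" where
  "chi_square_mixture k l =
     density lborel (\<lambda>x. ennreal ((1 / real k) * (\<Sum>i = 1..k. chi_square_density (l i) x)))"

text \<open>The joint law of \<open>m\<close> independent samples; a sample vector is a function on the index
  set \<open>{..<m}\<close>.\<close>

definition iid_samples :: "nat \<Rightarrow> real measure \<Rightarrow> (nat \<Rightarrow> real) measure" where
  "iid_samples m M = PiM {..<m} (\<lambda>_. M)"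

text \<open>An estimator is a deterministic Borel-measurable map from sample vectors to sets of degrees
  of freedom; the sets carry the discrete sigma-algebra.\<close>

definition set_estimator :: "nat \<Rightarrow> ((nat \<Rightarrow> real) \<Rightarrow> nat set) \<Rightarrow> bool" where
  "set_estimator m A \<longleftrightarrow>
     A \<in> measurable (PiM {..<m} (\<lambda>_. borel)) (count_space UNIV)"

end

theory Submission
  imports Defs "HOL-Probability.Hoeffding" "HOL-Complex_Analysis.Conformal_Mappings"
begin

text \<open>
  If \<open>X\<close> has law \<open>\<chi>\<^sup>2(l)\<close> then \<open>E exp (z X) = w ^ l\<close> with \<open>w = (1 - 2 z) powr (-1/2)\<close>, and
  \<open>exp (z X)\<close> is bounded by 1 when \<open>Re z \<le> 0\<close>, that is, when \<open>w\<close> lies in the right lobe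
  \<open>Re (1 / w\<^sup>2) \<ge> 1\<close> of Bernoulli's lemniscate.  For two mixtures of the same number of components the
  difference of these expectations is, up to the factor \<open>1 / k\<close>, a polynomial \<open>P w\<close> with coefficients
  in \<open>{-1, 0, 1}\<close> and degree at most \<open>N\<close>, so it suffices to find a point of the lobe where
  \<open>\<bar>P w\<bar> \<ge> exp (- c N powr (1/3))\<close>.  With \<open>h\<close> of order \<open>N powr (-1/3)\<close>, divide by the lowest power of
  \<open>w\<close> and look at the circle with centre \<open>1/4\<close> through \<open>1 - h\<^sup>2\<close>: its arc of length of order \<open>h\<close> around
  \<open>1 - h\<^sup>2\<close> lies in the lobe, and \<open>\<bar>w\<bar> ^ N \<ge> exp (- c N h\<^sup>2)\<close> there.  The maximum principle for the
  product of the rotations of \<open>P\<close> about the centre by multiples of \<open>2 \<pi> / n\<close>, \<open>n\<close> of order \<open>1 / h\<close>,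
  shows that \<open>P\<close> cannot be smaller than \<open>exp (- c n)\<close> on this arc, because it is bounded below at the
  centre.  Hoeffding's inequality and a union bound over the at most \<open>4 ^ N\<close> pairs of hypotheses turn
  the separating expectations into an estimator.
\<close>

section \<open>Polynomials with small coefficients near the point 1\<close>

lemma norm_one_minus_cis_le: "norm (1 - cis t) \<le> \<bar>t\<bar>"
proof -
  have "norm (1 - cis t) = \<bar>2 * sin (t / 2)\<bar>"
    using dist_exp_i_1[of t] by (simp add: cis_conv_exp norm_minus_commute mult.commute)
  also have "\<dots> \<le> \<bar>t\<bar>"
    using abs_sin_x_le_abs_x[of "t / 2"] by (simp add: abs_mult)
  finally show ?thesis .
qed

text \<open>The \<open>n\<close> rotations by multiples of \<open>2 * pi / n\<close> bring any unit
  number within half a step of 1: round its argument to the nearest step \<open>k\<close> and rotate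
  back by \<open>k\<close> steps, taken modulo \<open>n\<close>.\<close>

lemma rotation_near_one:
  fixes \<zeta> :: complex
  assumes "norm \<zeta> = 1" and "n > 0"
  obtains j where "j < n" and "norm (1 - \<zeta> * cis (2 * pi * real j / real n)) \<le> pi / real n"
proof -
  define \<psi> where "\<psi> = Arg \<zeta>"
  have \<zeta>: "\<zeta> = cis \<psi>"
    using assms(1) cis_Arg[of \<zeta>] by (cases "\<zeta> = 0") (auto simp: \<psi>_def sgn_eq)
  define k where "k = round (\<psi> * real n / (2 * pi))"
  define j where "j = nat ((- k) mod int n)"
  have j: "j < n" "int j = (- k) mod int n"
    using assms(2) by (auto simp: j_def nat_less_iff)
  obtain t where t: "int j = - k + int n * t"
    using j(2) by (metis minus_div_mult_eq_mod uminus_add_conv_diff mult.commute add.commute diff_minus_eq_add mult_minus_right)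
  have "real j = - of_int k + real n * of_int t"
    using arg_cong[OF t, of "of_int :: int \<Rightarrow> real"] by simp
  then have eq: "\<psi> + 2 * pi * real j / real n = (\<psi> - 2 * pi * of_int k / real n) + 2 * pi * of_int t"
    using assms(2) by (simp add: divide_simps) (simp add: algebra_simps)
  have "\<zeta> * cis (2 * pi * real j / real n) = cis (\<psi> - 2 * pi * of_int k / real n)"
    unfolding \<zeta> cis_mult eq by (simp flip: cis_mult)
  moreover have "\<bar>\<psi> - 2 * pi * of_int k / real n\<bar> \<le> pi / real n"
  proof -
    have "\<psi> - 2 * pi * of_int k / real n = - (2 * pi / real n) * (of_int k - \<psi> * real n / (2 * pi))"
      using assms(2) by (simp add: field_simps)
    then have "\<bar>\<psi> - 2 * pi * of_int k / real n\<bar> = (2 * pi / real n) * \<bar>of_int k - \<psi> * real n / (2 * pi)\<bar>"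
      by (simp add: abs_mult)
    also have "\<dots> \<le> (2 * pi / real n) * (1 / 2)"
      unfolding k_def by (intro mult_left_mono of_int_round_abs_le) auto
    finally show ?thesis by simp
  qed
  ultimately show ?thesis
    using that[of j] j(1) norm_one_minus_cis_le order_trans by metis
qed

text \<open>The product \<open>G\<close> of the \<open>n\<close> rotated copies of \<open>f\<close>
  takes the value \<open>f 0 ^ n\<close> at the centre. At each point of the circle one of the
  copies is evaluated on the arc near 1, so one factor is at most \<open>M\<close> and the others at
  most \<open>B\<close>; the maximum principle compares the two.\<close>

lemma holomorphic_center_power_le:
  fixes f :: "complex \<Rightarrow> complex" and B M :: real
  assumes hol: "f holomorphic_on ball 0 1" and cont: "continuous_on (cball 0 1) f"
    and n: "n > 0"
    and B: "\<And>\<zeta>. norm \<zeta> = 1 \<Longrightarrow> norm (f \<zeta>) \<le> B"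
    and M: "\<And>\<zeta>. norm \<zeta> = 1 \<Longrightarrow> norm (1 - \<zeta>) \<le> pi / real n \<Longrightarrow> norm (f \<zeta>) \<le> M"
  shows "norm (f 0) ^ n \<le> M * B ^ (n - 1)"
proof -
  define G where "G = (\<lambda>\<zeta>. \<Prod>j<n. f (\<zeta> * cis (2 * pi * real j / real n)))"
  have "norm (G 0) \<le> M * B ^ (n - 1)"
  proof (rule maximum_modulus_frontier[where S = "ball 0 1" and f = G and \<xi> = 0])
    show "G holomorphic_on interior (ball 0 1)"
      unfolding G_def interior_ball
      by (intro holomorphic_on_prod holomorphic_on_compose_gen[OF _ hol, unfolded o_def] holomorphic_intros)
        (auto simp: norm_mult)
    show "continuous_on (closure (ball 0 1)) G"
      unfolding G_def
      by (simp, intro continuous_on_prod continuous_on_compose2[OF cont] continuous_intros)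
        (auto simp: norm_mult)
  next
    fix \<zeta> :: complex
    assume "\<zeta> \<in> frontier (ball 0 1)"
    then have \<zeta>: "norm \<zeta> = 1"
      by simp
    obtain j where j: "j < n" "norm (1 - \<zeta> * cis (2 * pi * real j / real n)) \<le> pi / real n"
      using rotation_near_one[OF \<zeta> n] .
    have rot: "norm (\<zeta> * cis t) = 1" for t
      using \<zeta> by (simp add: norm_mult)
    have "norm (G \<zeta>) = norm (f (\<zeta> * cis (2 * pi * real j / real n))) *
        (\<Prod>i\<in>{..<n} - {j}. norm (f (\<zeta> * cis (2 * pi * real i / real n))))"
      unfolding G_def prod_norm[symmetric] using j(1) by (subst prod.remove[of _ j]) auto
    also have "\<dots> \<le> M * (\<Prod>i\<in>{..<n} - {j}. B)"
      using M[OF rot j(2)] B[OF rot]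
      by (intro mult_mono prod_mono prod_nonneg) (auto intro: order_trans[OF norm_ge_zero])
    finally show "norm (G \<zeta>) \<le> M * B ^ (n - 1)"
      using j(1) by simp
  qed auto
  then show ?thesis
    by (simp add: G_def norm_power)
qed

text \<open>In the half-plane \<open>Re w > 0\<close>, the condition \<open>Re (1 / w\<^sup>2) \<ge> 1\<close> cuts out the right lobe
  \<open>Re (w\<^sup>2) \<ge> \<bar>w\<bar> ^ 4\<close> of the lemniscate, whose boundary has distance of order \<open>t\<^sup>2\<close> from the unit
  circle at angle \<open>t\<close>; hence the square in the radius of the circle.\<close>

lemma circle_point_in_lemniscate:
  fixes h :: real and \<zeta> :: complex
  assumes h: "0 < h" "h \<le> 1 / 4" and \<zeta>: "norm \<zeta> = 1" "norm (1 - \<zeta>) \<le> 2 * h / 3"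
  defines "w \<equiv> 1 / 4 + of_real (3 / 4 - h\<^sup>2) * \<zeta>"
  shows "Re w > 0" and "1 - 3 * h\<^sup>2 \<le> (norm w)\<^sup>2"
    and "Re (1 / w\<^sup>2) \<ge> 1" and "norm (1 - 1 / w\<^sup>2) < 1"
proof -
  define r where "r = 3 / 4 - h\<^sup>2"
  define x y where "x = Re \<zeta>" and "y = Im \<zeta>"
  define \<rho> where "\<rho> = (norm w)\<^sup>2"
  have h2: "h\<^sup>2 \<le> 1 / 16" "h\<^sup>2 > 0"
    using h power_mono[of h "1 / 4" 2] by (auto simp: power2_eq_square)
  have r: "1 / 2 \<le> r" "r \<le> 3 / 4"
    using h2 by (auto simp: r_def)
  have xy: "x\<^sup>2 + y\<^sup>2 = 1"
    using \<zeta>(1) by (simp add: x_def y_def flip: cmod_power2)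
  have "(norm (1 - \<zeta>))\<^sup>2 \<le> (2 * h / 3)\<^sup>2"
    using \<zeta>(2) by (intro power_mono) auto
  moreover have "(norm (1 - \<zeta>))\<^sup>2 = (1 - x)\<^sup>2 + y\<^sup>2"
    by (simp add: cmod_power2 x_def y_def)
  moreover have "(1 - x)\<^sup>2 + y\<^sup>2 = 2 * (1 - x)"
    using xy by (simp add: power2_eq_square algebra_simps)
  ultimately have x1: "1 - x \<le> 2 * h\<^sup>2 / 9"
    by (simp add: power2_eq_square)
  have x2: "x \<le> 1"
    using complex_Re_le_cmod[of \<zeta>] \<zeta>(1) by (simp add: x_def)
  have y2: "y\<^sup>2 \<le> 4 * h\<^sup>2 / 9"
  proof -
    have "y\<^sup>2 = (1 - x) * (1 + x)"
      using xy by (simp add: power2_eq_square algebra_simps)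
    also have "\<dots> \<le> (2 * h\<^sup>2 / 9) * 2"
      using x1 x2 h2 by (intro mult_mono) auto
    finally show ?thesis by simp
  qed
  have Re_w: "Re w = 1 / 4 + r * x" and Im_w: "Im w = r * y"
    by (simp_all add: w_def r_def x_def y_def)
  have x_pos: "x > 0"
    using x1 h2 by auto
  show "Re w > 0"
    unfolding Re_w using r x_pos by (intro add_pos_nonneg mult_nonneg_nonneg) auto
  then have "w \<noteq> 0"
    by auto
  \<comment> \<open>The modulus is largest at \<open>\<zeta> = 1\<close>, where
    \<open>w = 1 - h^2\<close>; along the arc its square drops by at most \<open>h^2 / 12\<close>
    below that value.\<close>
  have \<rho>: "\<rho> = (1 / 4 + r)\<^sup>2 - r * (1 - x) / 2"
  proof -
    have "\<rho> = 1 / 16 + r * x / 2 + r\<^sup>2 * (x\<^sup>2 + y\<^sup>2)"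
      unfolding \<rho>_def cmod_power2 Re_w Im_w by (simp add: power2_eq_square algebra_simps)
    then show ?thesis
      unfolding xy by (simp add: power2_eq_square field_simps)
  qed
  have r_sq: "(1 / 4 + r)\<^sup>2 = 1 - 2 * h\<^sup>2 + (h\<^sup>2)\<^sup>2"
    by (simp add: r_def power2_eq_square algebra_simps)
  have h4: "0 \<le> (h\<^sup>2)\<^sup>2" "(h\<^sup>2)\<^sup>2 \<le> h\<^sup>2"
    using h2 mult_right_mono[of "h\<^sup>2" 1 "h\<^sup>2"] by (auto simp: power2_eq_square[of "h\<^sup>2"])
  have "r * (1 - x) \<le> (3 / 4) * (2 * h\<^sup>2 / 9)"
    using r x1 x2 by (intro mult_mono) auto
  moreover have "0 \<le> r * (1 - x)"
    using r x2 by auto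
  ultimately have \<rho>1: "1 - 3 * h\<^sup>2 \<le> \<rho>" and \<rho>2: "\<rho> \<le> 1 - h\<^sup>2"
    unfolding \<rho> r_sq using h4 h2 by linarith+
  show "1 - 3 * h\<^sup>2 \<le> (norm w)\<^sup>2"
    using \<rho>1 by (simp add: \<rho>_def)
  have Re_w2: "Re (w\<^sup>2) \<ge> \<rho> - h\<^sup>2 / 2"
  proof -
    have "r\<^sup>2 * y\<^sup>2 \<le> (3 / 4)\<^sup>2 * (4 * h\<^sup>2 / 9)"
      using y2 r by (intro mult_mono power_mono) auto
    then have "2 * (Im w)\<^sup>2 \<le> h\<^sup>2 / 2"
      by (simp add: Im_w power_mult_distrib) (simp add: power2_eq_square)
    moreover have "Re (w\<^sup>2) = \<rho> - 2 * (Im w)\<^sup>2"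
      by (simp add: \<rho>_def cmod_power2 Re_power2)
    ultimately show ?thesis by linarith
  qed
  have nw2: "(norm (w\<^sup>2))\<^sup>2 = \<rho>\<^sup>2"
    by (simp add: \<rho>_def norm_power)
  \<comment> \<open>Since \<open>Re (w^2)\<close> is at least \<open>\<rho> - h^2 / 2\<close>, this
    is all that the lemniscate condition requires; it holds because
    \<open>\<rho> \<ge> 1 / 2\<close> and \<open>1 - \<rho> \<ge> h^2\<close>.\<close>
  have "1 / 2 * h\<^sup>2 \<le> \<rho> * (1 - \<rho>)"
    using \<rho>1 \<rho>2 h2 by (intro mult_mono) auto
  then have "\<rho>\<^sup>2 \<le> Re (w\<^sup>2)"
    using Re_w2 by (simp add: power2_eq_square algebra_simps)
  moreover have "\<rho>\<^sup>2 > 0"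
    using \<open>w \<noteq> 0\<close> by (simp add: \<rho>_def)
  ultimately have "1 \<le> Re (w\<^sup>2) / \<rho>\<^sup>2"
    by simp
  also have "\<dots> = Re (1 / w\<^sup>2)"
    using nw2 by (simp add: Re_divide cmod_power2)
  finally show "Re (1 / w\<^sup>2) \<ge> 1" .
  \<comment> \<open>The last claim amounts to \<open>Re (w^2) > 1 / 2\<close>.\<close>
  have "(norm (w\<^sup>2 - 1))\<^sup>2 = (norm (w\<^sup>2))\<^sup>2 - 2 * Re (w\<^sup>2) + 1"
    unfolding cmod_power2 by (simp add: power2_eq_square algebra_simps)
  also have "\<dots> < (norm (w\<^sup>2))\<^sup>2"
    using Re_w2 \<rho>1 h2 by simp
  finally have "norm (w\<^sup>2 - 1) < norm (w\<^sup>2)"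
    by (rule power2_less_imp_less) simp
  moreover have "1 - 1 / w\<^sup>2 = (w\<^sup>2 - 1) / w\<^sup>2"
    using \<open>w \<noteq> 0\<close> by (simp add: field_simps)
  ultimately show "norm (1 - 1 / w\<^sup>2) < 1"
    using \<open>w \<noteq> 0\<close> by (simp add: norm_divide)
qed

section \<open>Lower bounds for polynomials near the point 1\<close>

text \<open>Both bounds compare with the geometric series. The second serves at the centre
  \<open>1 / 4\<close>, where a unimodular \<open>e 0\<close> gives
  \<open>1 - 1 / 3\<close>.\<close>

lemma power_series_section_bounds:
  fixes e :: "nat \<Rightarrow> complex" and w :: complex
  assumes e: "\<And>j. norm (e j) \<le> 1" and w: "norm w < 1"
  shows "norm (\<Sum>j\<le>N. e j * w ^ j) \<le> 1 / (1 - norm w)"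
    and "norm (\<Sum>j\<le>N. e j * w ^ j) \<ge> norm (e 0) - norm w / (1 - norm w)"
proof -
  have geo: "(\<Sum>j\<le>K. norm w ^ j) \<le> 1 / (1 - norm w)" for K
  proof -
    have "(\<Sum>j\<le>K. norm w ^ j) \<le> (\<Sum>j. norm w ^ j)"
      using w by (intro sum_le_suminf summable_geometric) auto
    then show ?thesis
      using w by (simp add: suminf_geometric)
  qed
  have bound: "norm (\<Sum>j\<le>K. c j * w ^ j) \<le> 1 / (1 - norm w)"
    if "\<And>j. norm (c j) \<le> 1" for c :: "nat \<Rightarrow> complex" and K
  proof -
    have "norm (\<Sum>j\<le>K. c j * w ^ j) \<le> (\<Sum>j\<le>K. norm w ^ j)"
      using that by (intro sum_norm_le) (simp add: norm_mult norm_power mult_left_le_one_le)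
    then show ?thesis
      using geo by (rule order_trans)
  qed
  show "norm (\<Sum>j\<le>N. e j * w ^ j) \<le> 1 / (1 - norm w)"
    by (rule bound[OF e])
  show "norm (\<Sum>j\<le>N. e j * w ^ j) \<ge> norm (e 0) - norm w / (1 - norm w)"
  proof (cases N)
    case 0
    then show ?thesis using w by simp
  next
    case (Suc K)
    have eq: "(\<Sum>j\<le>N. e j * w ^ j) = e 0 + w * (\<Sum>j\<le>K. e (Suc j) * w ^ j)"
      unfolding Suc sum.atMost_Suc_shift by (simp add: sum_distrib_left mult_ac)
    have "norm (w * (\<Sum>j\<le>K. e (Suc j) * w ^ j)) \<le> norm w * (1 / (1 - norm w))"
      unfolding norm_mult by (intro mult_left_mono bound e) auto
    then show ?thesis
      unfolding eq using norm_diff_ineq[of "e 0" "w * (\<Sum>j\<le>K. e (Suc j) * w ^ j)"] by simp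
  qed
qed

text \<open>After mapping the unit circle to the circle with centre \<open>1 / 4\<close> through
  \<open>1 - h^2\<close>, the damped polynomial \<open>f\<close> is at most 16 on the circle and at
  least \<open>2 / 3\<close> at the centre, so \<open>holomorphic_center_power_le\<close> forbids it
  to be tiny on the arc inside the lemniscate.\<close>

lemma power_series_section_large_near_one:
  fixes e :: "nat \<Rightarrow> complex" and q :: nat
  assumes e: "\<And>j. norm (e j) \<le> 1" "norm (e 0) = 1" and q: "q > 0"
  defines "h \<equiv> 1 / (4 * real q)"
  obtains w where "Re w > 0" "1 - 3 * h\<^sup>2 \<le> (norm w)\<^sup>2" "Re (1 / w\<^sup>2) \<ge> 1" "norm (1 - 1 / w\<^sup>2) < 1"
    and "(1 / 24) ^ (24 * q) \<le> norm (\<Sum>j\<le>N. e j * w ^ j)"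
proof -
  define Q where "Q = (\<lambda>w. \<Sum>j\<le>N. e j * w ^ j)"
  define r where "r = 3 / 4 - h\<^sup>2"
  \<comment> \<open>The factor \<open>(1 - \<zeta>)\<^sup>2\<close> absorbs the bound \<open>1 / (1 - \<bar>w\<bar>)\<close> for \<open>Q\<close>, so that no logarithm of \<open>N\<close>
    is lost.\<close>
  define f where "f = (\<lambda>\<zeta>. Q (1 / 4 + of_real r * \<zeta>) * (1 - \<zeta>)\<^sup>2)"
  \<comment> \<open>As \<open>pi < 4\<close>, this makes \<open>pi / n\<close> at most
    \<open>1 / (6 * q) = 2 * h / 3\<close>, the width of the arc known to lie in the
    lemniscate.\<close>
  define n where "n = 24 * q"
  have h: "0 < h" "h \<le> 1 / 4"
    using q by (auto simp: h_def field_simps)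
  have h2: "h\<^sup>2 \<le> 1 / 16" "h\<^sup>2 > 0"
    using h power_mono[of h "1 / 4" 2] by (auto simp: power2_eq_square)
  have r: "1 / 2 \<le> r" "r < 3 / 4"
    using h2 by (auto simp: r_def)
  have n: "n > 0" "pi / real n \<le> 2 * h / 3"
    using q pi_less_4 by (auto simp: n_def h_def field_simps)
  have f_hol: "f holomorphic_on UNIV"
    unfolding f_def Q_def by (intro holomorphic_intros)
  have f_bound: "norm (f \<zeta>) \<le> 16" if \<zeta>: "norm \<zeta> = 1" for \<zeta>
  proof -
    define w where "w = 1 / 4 + of_real r * \<zeta>"
    have "norm w \<le> 1 / 4 + r"
      unfolding w_def using r \<zeta> by (intro order_trans[OF norm_triangle_ineq]) (simp add: norm_mult)
    then have w1: "norm w < 1"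
      using r by simp
    have "(Re \<zeta>)\<^sup>2 + (Im \<zeta>)\<^sup>2 = 1"
      using \<zeta> by (simp flip: cmod_power2)
    then have Im2: "(Im \<zeta>)\<^sup>2 = 1 - (Re \<zeta>)\<^sup>2"
      by simp
    \<comment> \<open>The circle is closest to the unit circle at \<open>\<zeta> = 1\<close>, and
      \<open>1 - norm w\<close> grows at least quadratically in \<open>norm (1 - \<zeta>)\<close>;
      hence a squared damping factor.\<close>
    have w2: "(norm w)\<^sup>2 = (1 / 4 + r)\<^sup>2 - r / 4 * (norm (1 - \<zeta>))\<^sup>2"
      unfolding cmod_power2 by (simp add: w_def power_mult_distrib Im2 power2_sum power2_diff algebra_simps)
    have "(1 / 8) * (norm (1 - \<zeta>))\<^sup>2 \<le> r / 4 * (norm (1 - \<zeta>))\<^sup>2"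
      using r by (intro mult_right_mono) auto
    also have "\<dots> = (1 / 4 + r)\<^sup>2 - (norm w)\<^sup>2"
      unfolding w2 by simp
    also have "\<dots> \<le> 1 - (norm w)\<^sup>2"
      using r by (intro diff_right_mono power_le_one) auto
    finally have "(norm (1 - \<zeta>))\<^sup>2 \<le> 8 * (1 - (norm w)\<^sup>2)"
      by simp
    also have "\<dots> = 8 * (1 + norm w) * (1 - norm w)"
      by (simp add: power2_eq_square algebra_simps)
    also have "\<dots> \<le> 16 * (1 - norm w)"
      using w1 by (intro mult_right_mono) auto
    finally have d: "(norm (1 - \<zeta>))\<^sup>2 \<le> 16 * (1 - norm w)" .
    have "norm (f \<zeta>) = norm (Q w) * (norm (1 - \<zeta>))\<^sup>2"
      by (simp add: f_def w_def norm_mult norm_power)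
    also have "\<dots> \<le> (1 / (1 - norm w)) * (16 * (1 - norm w))"
      unfolding Q_def using d w1 e(1)
      by (intro mult_mono power_series_section_bounds) auto
    also have "\<dots> = 16"
      using w1 by (simp add: divide_simps)
    finally show ?thesis .
  qed
  have f0: "norm (f 0) \<ge> 2 / 3"
    using power_series_section_bounds(2)[of e "1 / 4" N] e by (simp add: f_def Q_def norm_divide)
  \<comment> \<open>The base \<open>1 / 24\<close> is \<open>2 / 3\<close> divided by the bound
    16.\<close>
  have "\<exists>\<zeta>. norm \<zeta> = 1 \<and> norm (1 - \<zeta>) \<le> pi / real n \<and> (1 / 24) ^ n \<le> norm (f \<zeta>)"
  proof (rule ccontr)
    assume "\<not> ?thesis"
    then have "norm (f 0) ^ n \<le> (1 / 24) ^ n * 16 ^ (n - 1)"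
      using n(1) f_bound
      by (intro holomorphic_center_power_le holomorphic_on_subset[OF f_hol]
          holomorphic_on_imp_continuous_on) (auto simp: not_le less_imp_le)
    also have "\<dots> < (1 / 24) ^ n * 16 ^ n"
      using n(1) by (intro mult_strict_left_mono power_strict_increasing) auto
    also have "\<dots> = (2 / 3) ^ n"
      by (simp flip: power_mult_distrib)
    also have "\<dots> \<le> norm (f 0) ^ n"
      using f0 by (intro power_mono) auto
    finally show False by simp
  qed
  then obtain \<zeta> where \<zeta>: "norm \<zeta> = 1" "norm (1 - \<zeta>) \<le> pi / real n" "(1 / 24) ^ n \<le> norm (f \<zeta>)"
    by blast
  have d: "norm (1 - \<zeta>) \<le> 2 * h / 3"
    using \<zeta>(2) n(2) by (rule order_trans)
  note lem = circle_point_in_lemniscate[OF h \<zeta>(1) d, folded r_def]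
  have "norm (f \<zeta>) = norm (Q (1 / 4 + of_real r * \<zeta>)) * (norm (1 - \<zeta>))\<^sup>2"
    by (simp add: f_def norm_mult norm_power)
  also have "\<dots> \<le> norm (Q (1 / 4 + of_real r * \<zeta>)) * 1"
    using d h by (intro mult_left_mono power_le_one) auto
  finally show ?thesis
    using that[OF lem] \<zeta>(3) by (simp add: Q_def n_def)
qed

text \<open>Dividing by \<open>w ^ a\<close>, with \<open>a\<close> the lowest exponent present,
  leaves a polynomial with unimodular constant term, to which the previous bound applies. Restoring
  \<open>w ^ a\<close> costs only \<open>exp (- q)\<close>.\<close>

lemma littlewood_polynomial_large_on_lemniscate:
  fixes e :: "nat \<Rightarrow> complex" and N q :: nat
  assumes e: "\<And>l. e l = 0 \<or> norm (e l) = 1" and ex: "\<exists>l\<in>{1..N}. e l \<noteq> 0"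
    and q: "q > 0" "N \<le> q ^ 3"
  obtains w where "Re w > 0" "Re (1 / w\<^sup>2) \<ge> 1" "norm (1 - 1 / w\<^sup>2) < 1"
    and "exp (- (600 * real q)) \<le> norm (\<Sum>l\<in>{1..N}. e l * w ^ l)"
proof -
  define a where "a = (LEAST l. l \<in> {1..N} \<and> e l \<noteq> 0)"
  have "a \<in> {1..N} \<and> e a \<noteq> 0"
    unfolding a_def by (rule LeastI_ex) (use ex in blast)
  then have a: "a \<in> {1..N}" "e a \<noteq> 0"
    by blast+
  have less_a: "e l = 0" if "l \<in> {1..N}" "l < a" for l
    using not_less_Least[of l "\<lambda>l. l \<in> {1..N} \<and> e l \<noteq> 0"] that by (auto simp: a_def)
  define h where "h = 1 / (4 * real q)"
  have e_a: "norm (e (a + j)) \<le> 1" "norm (e (a + 0)) = 1" for j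
    using e[of "a + j"] e[of a] a(2) by auto
  from power_series_section_large_near_one[of "\<lambda>j. e (a + j)", OF e_a q(1), folded h_def]
  obtain w where w: "Re w > 0" "1 - 3 * h\<^sup>2 \<le> (norm w)\<^sup>2" "Re (1 / w\<^sup>2) \<ge> 1" "norm (1 - 1 / w\<^sup>2) < 1"
    and Q: "(1 / 24) ^ (24 * q) \<le> norm (\<Sum>j\<le>N - a. e (a + j) * w ^ j)"
    by blast
  have "(\<Sum>l\<in>{1..N}. e l * w ^ l) = (\<Sum>l\<in>{a..N}. e l * w ^ l)"
    using a less_a by (intro sum.mono_neutral_right) auto
  also have "\<dots> = (\<Sum>j\<le>N - a. e (a + j) * w ^ (a + j))"
    using a(1) by (intro sum.reindex_bij_witness[of _ "\<lambda>j. a + j" "\<lambda>l. l - a"]) auto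
  also have "\<dots> = w ^ a * (\<Sum>j\<le>N - a. e (a + j) * w ^ j)"
    by (simp add: sum_distrib_left power_add mult_ac)
  finally have P: "norm (\<Sum>l\<in>{1..N}. e l * w ^ l) =
      norm w ^ a * norm (\<Sum>j\<le>N - a. e (a + j) * w ^ j)"
    by (simp add: norm_mult norm_power)
  have "0 \<le> h" "h \<le> 1 / 4"
    using q(1) by (auto simp: h_def field_simps)
  then have h2: "h\<^sup>2 = 1 / (16 * real q ^ 2)" "0 \<le> h\<^sup>2" "h\<^sup>2 \<le> 1 / 16"
    using power_mono[of h "1 / 4" 2] by (auto simp: h_def power2_eq_square)
  \<comment> \<open>If \<open>norm w < 1\<close>, the worst exponent is \<open>N\<close>. The square
    of the modulus is at least \<open>1 - 3 * h^2 \<ge> exp (- 6 * h^2)\<close>, and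
    \<open>6 * h^2 * N\<close> is at most \<open>q\<close> because \<open>h = 1 / (4 * q)\<close>
    and \<open>N \<le> q ^ 3\<close>.\<close>
  have norm_w: "norm w ^ a \<ge> exp (- real q)"
  proof (cases "norm w \<ge> 1")
    case True
    have "exp (- real q) \<le> 1"
      by simp
    also have "1 \<le> norm w ^ a"
      using True by (rule one_le_power)
    finally show ?thesis .
  next
    case False
    have "exp (- real q) \<le> exp (- (6 * h\<^sup>2)) ^ N"
    proof -
      have "real N \<le> real q ^ 3"
        using q(2) by (metis of_nat_le_iff of_nat_power)
      then have "real N * (6 * h\<^sup>2) \<le> real q ^ 3 * (6 * h\<^sup>2)"
        using h2 by (intro mult_right_mono) auto
      also have "\<dots> \<le> real q"
        unfolding h2(1) using q(1) by (simp add: power2_eq_square power3_eq_cube field_simps)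
      finally show ?thesis
        by (simp flip: exp_of_nat_mult)
    qed
    also have "\<dots> \<le> (1 - 3 * h\<^sup>2) ^ N"
    proof (intro power_mono)
      have "1 \<le> (1 - 3 * h\<^sup>2) * (1 + 6 * h\<^sup>2)"
        using h2 mult_right_mono[of "18 * h\<^sup>2" 3 "h\<^sup>2"] by (simp add: algebra_simps)
      also have "\<dots> \<le> (1 - 3 * h\<^sup>2) * exp (6 * h\<^sup>2)"
        using h2 exp_ge_add_one_self by (intro mult_left_mono) auto
      finally show "exp (- (6 * h\<^sup>2)) \<le> 1 - 3 * h\<^sup>2"
        by (simp add: exp_minus field_simps)
    qed auto
    also have "\<dots> \<le> ((norm w)\<^sup>2) ^ N"
      using w(2) h2 by (intro power_mono) auto
    also have "\<dots> \<le> norm w ^ N"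
      using False by (intro power_mono) (auto simp: power2_eq_square mult_left_le)
    also have "\<dots> \<le> norm w ^ a"
      using False a(1) by (intro power_decreasing) auto
    finally show ?thesis .
  qed
  \<comment> \<open>This crude bound turns \<open>(1 / 24) ^ (24 * q)\<close> into
    \<open>exp (- 576 * q)\<close>; with the loss \<open>exp (- q)\<close> this stays above
    \<open>exp (- 600 * q)\<close>.\<close>
  have "exp (- (24 :: real)) \<le> 1 / 24"
    using exp_ge_add_one_self[of "24::real"] by (simp add: exp_minus field_simps)
  then have "exp (- 24) ^ (24 * q) \<le> (1 / 24 :: real) ^ (24 * q)"
    by (intro power_mono) auto
  then have "exp (- (576 * real q)) \<le> (1 / 24) ^ (24 * q)"
    by (simp flip: exp_of_nat_mult)
  then have "exp (- real q) * exp (- (576 * real q)) \<le> norm (\<Sum>l\<in>{1..N}. e l * w ^ l)"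
    unfolding P using norm_w Q by (intro mult_mono) auto
  moreover have "exp (- (600 * real q)) \<le> exp (- real q) * exp (- (576 * real q))"
    by (simp flip: exp_add)
  ultimately show ?thesis
    using that w by (meson order_trans)
qed

section \<open>From separating tests to estimators\<close>

lemma indep_vars_PiM_coordinates:
  assumes "\<And>i. i \<in> I \<Longrightarrow> prob_space (M i)" and "I \<noteq> {}"
  shows "prob_space.indep_vars (PiM I M) M (\<lambda>i \<omega>. \<omega> i) I"
proof -
  interpret prob_space "PiM I M"
    using assms(1) by (rule prob_space_PiM)
  have "distr (PiM I M) (PiM I M) (\<lambda>x. \<lambda>i\<in>I. x i) = distr (PiM I M) (PiM I M) (\<lambda>x. x)"
    by (intro distr_cong) (auto simp: space_PiM PiE_def extensional_restrict)
  also have "\<dots> = PiM I (\<lambda>i. distr (PiM I M) (M i) (\<lambda>x. x i))"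
    unfolding distr_id by (intro PiM_cong) (auto simp: distr_PiM_component assms)
  finally show ?thesis
    using assms(2) by (subst indep_vars_iff_distr_eq_PiM') auto
qed

text \<open>Hoeffding's inequality for summands in \<open>[-1, 1]\<close>: the squared widths add up
  to \<open>4 * m\<close>, which gives the exponent
  \<open>- 2 * (m * \<epsilon>)^2 / (4 * m)\<close>.\<close>

lemma iid_empirical_mean_deviation:
  fixes f :: "'a \<Rightarrow> real" and m :: nat
  assumes "prob_space M" and [measurable]: "f \<in> borel_measurable M"
    and f: "\<And>x. \<bar>f x\<bar> \<le> 1" and m: "m > 0" and \<epsilon>: "\<epsilon> \<ge> 0"
  shows "measure (PiM {..<m} (\<lambda>_. M))
      {x \<in> space (PiM {..<m} (\<lambda>_. M)). \<bar>(\<Sum>i<m. f (x i)) / real m - (\<integral>y. f y \<partial>M)\<bar> \<ge> \<epsilon>}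
    \<le> 2 * exp (- (real m * \<epsilon>\<^sup>2 / 2))"
proof -
  let ?P = "PiM {..<m} (\<lambda>_. M)"
  interpret P: prob_space ?P
    by (intro prob_space_PiM assms(1))
  interpret Hoeffding_ineq ?P "{..<m}" "\<lambda>i x. f (x i)" "\<lambda>_. -1" "\<lambda>_. 1" "\<Sum>i<m. P.expectation (\<lambda>x. f (x i))"
  proof unfold_locales
    show "P.indep_vars (\<lambda>_. borel) (\<lambda>i x. f (x i)) {..<m}"
      by (rule P.indep_vars_compose2[OF indep_vars_PiM_coordinates[OF assms(1)]]) (use m in auto)
    show "AE x in ?P. f (x i) \<in> {-1..1}" for i
      using f by (intro AE_I2) (simp add: abs_le_iff minus_le_iff)
  qed auto
  have "P.expectation (\<lambda>x. f (x i)) = (\<integral>y. f y \<partial>M)" if "i < m" for i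
    using integral_distr[of "\<lambda>x. x i" ?P M f] distr_PiM_component[of "{..<m}" "\<lambda>_. M" i] that assms(1)
    by simp
  then have \<mu>: "(\<Sum>i<m. P.expectation (\<lambda>x. f (x i))) = real m * (\<integral>y. f y \<partial>M)"
    by simp
  have "{x \<in> space ?P. \<bar>(\<Sum>i<m. f (x i)) / real m - (\<integral>y. f y \<partial>M)\<bar> \<ge> \<epsilon>} =
      {x \<in> space ?P. \<bar>(\<Sum>i<m. f (x i)) - real m * (\<integral>y. f y \<partial>M)\<bar> \<ge> real m * \<epsilon>}"
  proof (intro Collect_cong conj_cong refl)
    fix x
    have "(\<Sum>i<m. f (x i)) - real m * (\<integral>y. f y \<partial>M) =
        real m * ((\<Sum>i<m. f (x i)) / real m - (\<integral>y. f y \<partial>M))"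
      using m by (simp add: right_diff_distrib)
    then have "\<bar>(\<Sum>i<m. f (x i)) - real m * (\<integral>y. f y \<partial>M)\<bar> =
        real m * \<bar>(\<Sum>i<m. f (x i)) / real m - (\<integral>y. f y \<partial>M)\<bar>"
      by (simp add: abs_mult)
    then show "\<epsilon> \<le> \<bar>(\<Sum>i<m. f (x i)) / real m - (\<integral>y. f y \<partial>M)\<bar> \<longleftrightarrow>
        real m * \<epsilon> \<le> \<bar>(\<Sum>i<m. f (x i)) - real m * (\<integral>y. f y \<partial>M)\<bar>"
      using m by simp
  qed
  also have "P.prob \<dots> \<le> 2 * exp (- 2 * (real m * \<epsilon>)\<^sup>2 / (\<Sum>i<m. (1 - (- 1))\<^sup>2))"
    using Hoeffding_ineq_abs_ge[of "real m * \<epsilon>"] m \<epsilon> unfolding \<mu> by simp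
  also have "- 2 * (real m * \<epsilon>)\<^sup>2 / (\<Sum>i<m. (1 - (- 1))\<^sup>2) = - (real m * \<epsilon>\<^sup>2 / 2)"
    using m by (simp add: power2_eq_square)
  finally show ?thesis .
qed

text \<open>The estimator selects a hypothesis whose predicted means match all empirical test means
  to within \<open>\<epsilon> / 2\<close>. Separation allows at most one such hypothesis, and the
  true one qualifies unless one of the \<open>card \<Theta> ^ 2\<close> tests deviates by
  \<open>\<epsilon> / 2\<close>, hence the 8 in the exponent.\<close>

lemma estimator_from_separating_tests:
  fixes M :: "'s \<Rightarrow> 'a measure" and f :: "'s \<Rightarrow> 's \<Rightarrow> 'a \<Rightarrow> real" and \<Theta> :: "'s set"
  assumes fin: "finite \<Theta>" and M: "\<And>s. s \<in> \<Theta> \<Longrightarrow> prob_space (M s)" "\<And>s. s \<in> \<Theta> \<Longrightarrow> sets (M s) = sets N"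
    and f: "\<And>s t. s \<in> \<Theta> \<Longrightarrow> t \<in> \<Theta> \<Longrightarrow> f s t \<in> borel_measurable N"
      "\<And>s t x. s \<in> \<Theta> \<Longrightarrow> t \<in> \<Theta> \<Longrightarrow> \<bar>f s t x\<bar> \<le> 1"
    and sep: "\<And>s t. s \<in> \<Theta> \<Longrightarrow> t \<in> \<Theta> \<Longrightarrow> s \<noteq> t \<Longrightarrow> \<epsilon> \<le> \<bar>(\<integral>x. f s t x \<partial>M s) - (\<integral>x. f s t x \<partial>M t)\<bar>"
    and \<epsilon>: "\<epsilon> \<ge> 0" and m: "m > 0"
  obtains A where "A \<in> measurable (PiM {..<m} (\<lambda>_. N)) (count_space UNIV)"
    and "\<And>s. s \<in> \<Theta> \<Longrightarrow> measure (PiM {..<m} (\<lambda>_. M s)) {x \<in> space (PiM {..<m} (\<lambda>_. M s)). A x = s}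
           \<ge> 1 - 2 * (real (card \<Theta>))\<^sup>2 * exp (- (real m * \<epsilon>\<^sup>2 / 8))"
proof -
  define P where "P = PiM {..<m} (\<lambda>_. N)"
  define dev where "dev = (\<lambda>s u v x. \<bar>(\<Sum>i<m. f u v (x i)) / real m - (\<integral>y. f u v y \<partial>M s)\<bar>)"
  define good where "good = (\<lambda>s x. \<forall>u\<in>\<Theta>. \<forall>v\<in>\<Theta>. dev s u v x < \<epsilon> / 2)"
  define h where "h = (\<lambda>x. {s \<in> \<Theta>. good s x})"
  define A where "A = (\<lambda>x. SOME s. s \<in> h x)"
  have dev_meas: "dev s u v \<in> borel_measurable P" if "u \<in> \<Theta>" "v \<in> \<Theta>" for s u v
    using f(1)[OF that] unfolding dev_def P_def by measurable
  have good_meas: "Measurable.pred P (good s)" for s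
  proof -
    have "Measurable.pred P (\<lambda>x. dev s u v x < \<epsilon> / 2)" if "u \<in> \<Theta>" "v \<in> \<Theta>" for u v
      using dev_meas[OF that] by measurable
    then show ?thesis
      unfolding good_def by (intro pred_intros_finite fin)
  qed
  \<comment> \<open>\<open>A\<close> depends on the sample only through \<open>h\<close>, which
    takes finitely many values; measurability of \<open>h\<close> therefore settles that of
    \<open>A\<close>, however \<open>SOME\<close> chooses.\<close>
  have "h \<in> measurable P (count_space (Pow \<Theta>))"
  proof (subst measurable_count_space_eq2)
    have "h -` {U} \<inter> space P \<in> sets P" if "U \<subseteq> \<Theta>" for U
    proof -
      have "h -` {U} \<inter> space P = {x \<in> space P. \<forall>s\<in>\<Theta>. s \<in> U \<longleftrightarrow> good s x}"
        using that by (auto simp: h_def)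
      also have "\<dots> \<in> sets P"
        using good_meas fin by measurable
      finally show ?thesis .
    qed
    then show "h \<in> space P \<rightarrow> Pow \<Theta> \<and> (\<forall>a\<in>Pow \<Theta>. h -` {a} \<inter> space P \<in> sets P)"
      by (auto simp: h_def)
  qed (use fin in auto)
  then have A_meas: "A \<in> measurable P (count_space UNIV)"
    unfolding A_def by (rule measurable_compose) auto
  have A_good: "A x = s" if "s \<in> \<Theta>" "good s x" for s x
  proof -
    have "t = s" if "t \<in> \<Theta>" "good t x" for t
    proof (rule ccontr)
      assume "t \<noteq> s"
      \<comment> \<open>Both inequalities concern the same empirical mean, that of the test
        \<open>f t s\<close>, so the triangle inequality applies.\<close>
      have "dev t t s x < \<epsilon> / 2" "dev s t s x < \<epsilon> / 2"
        using that \<open>s \<in> \<Theta>\<close> \<open>good s x\<close> by (auto simp: good_def)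
      then have "\<bar>(\<integral>x. f t s x \<partial>M t) - (\<integral>x. f t s x \<partial>M s)\<bar> < \<epsilon>"
        unfolding dev_def by linarith
      then show False
        using sep[of t s] that \<open>s \<in> \<Theta>\<close> \<open>t \<noteq> s\<close> by auto
    qed
    then have "h x = {s}"
      using that unfolding h_def by blast
    then show ?thesis
      by (simp add: A_def)
  qed
  have "measure (PiM {..<m} (\<lambda>_. M s)) {x \<in> space (PiM {..<m} (\<lambda>_. M s)). A x = s}
      \<ge> 1 - 2 * (real (card \<Theta>))\<^sup>2 * exp (- (real m * \<epsilon>\<^sup>2 / 8))" if s: "s \<in> \<Theta>" for s
  proof -
    let ?Q = "PiM {..<m} (\<lambda>_. M s)"
    interpret Q: prob_space ?Q
      by (intro prob_space_PiM M s)
    have sets_Q: "sets ?Q = sets P"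
      unfolding P_def by (intro sets_PiM_cong M s refl)
    note meas_Q = measurable_cong_sets[OF sets_Q refl]
    define bad where "bad = (\<lambda>(u, v). {x \<in> space ?Q. dev s u v x \<ge> \<epsilon> / 2})"
    have bad_meas: "bad p \<in> sets ?Q" if "p \<in> \<Theta> \<times> \<Theta>" for p
    proof -
      have "dev s (fst p) (snd p) \<in> borel_measurable ?Q"
        using dev_meas that by (auto simp: meas_Q)
      then show ?thesis
        unfolding bad_def by (auto simp: case_prod_beta)
    qed
    have bad_prob: "Q.prob (bad p) \<le> 2 * exp (- (real m * \<epsilon>\<^sup>2 / 8))" if "p \<in> \<Theta> \<times> \<Theta>" for p
    proof -
      from that obtain u v where p: "p = (u, v)" "u \<in> \<Theta>" "v \<in> \<Theta>"
        by auto
      have "f u v \<in> borel_measurable (M s)"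
        using f(1)[OF p(2,3)] M(2)[OF s] by (simp cong: measurable_cong_sets)
      from iid_empirical_mean_deviation[OF M(1)[OF s] this f(2)[OF p(2,3)] m, of "\<epsilon> / 2"] \<epsilon>
      show ?thesis
        by (simp add: bad_def p(1) dev_def power_divide)
    qed
    have good_sets: "{x \<in> space ?Q. A x = s} \<in> sets ?Q"
      using A_meas unfolding meas_Q[symmetric] by measurable
    have "1 - Q.prob {x \<in> space ?Q. A x = s} = Q.prob (space ?Q - {x \<in> space ?Q. A x = s})"
      using good_sets by (simp add: Q.prob_compl)
    also have "\<dots> \<le> Q.prob (\<Union>p\<in>\<Theta> \<times> \<Theta>. bad p)"
    proof (rule Q.finite_measure_mono)
      show "space ?Q - {x \<in> space ?Q. A x = s} \<subseteq> (\<Union>p\<in>\<Theta> \<times> \<Theta>. bad p)"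
        using A_good[OF s] by (force simp: good_def bad_def)
    qed (use fin bad_meas in auto)
    also have "\<dots> \<le> (\<Sum>p\<in>\<Theta> \<times> \<Theta>. Q.prob (bad p))"
      using fin bad_meas by (intro Q.finite_measure_subadditive_finite) auto
    also have "\<dots> \<le> (\<Sum>p\<in>\<Theta> \<times> \<Theta>. 2 * exp (- (real m * \<epsilon>\<^sup>2 / 8)))"
      by (intro sum_mono bad_prob)
    also have "\<dots> = 2 * (real (card \<Theta>))\<^sup>2 * exp (- (real m * \<epsilon>\<^sup>2 / 8))"
      by (simp add: card_cartesian_product power2_eq_square)
    finally show ?thesis
      by simp
  qed
  then show ?thesis
    using that A_meas unfolding P_def by blast
qed

section \<open>The chi-squared distribution\<close>

lemma borel_measurable_chi_square_density [measurable]: "chi_square_density l \<in> borel_measurable borel"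
  unfolding chi_square_density_def by measurable

lemma chi_square_density_nonneg: "chi_square_density l x \<ge> 0"
  by (cases "l = 0") (auto simp: chi_square_density_def intro!: divide_nonneg_nonneg mult_nonneg_nonneg Gamma_real_nonneg)

lemma chi_square_density_times_power_nonneg: "chi_square_density l x * x ^ n \<ge> 0"
proof (cases "x > 0")
  case True
  then show ?thesis
    by (intro mult_nonneg_nonneg chi_square_density_nonneg) auto
qed (simp add: chi_square_density_def)

text \<open>The substitution \<open>x = 2 * t\<close> reduces the moment to the Gamma integral at
  \<open>l / 2 + n\<close>, and a quotient of Gamma values is a \<open>pochhammer\<close>
  symbol.\<close>

lemma has_bochner_integral_chi_square_moment:
  assumes "l > 0"
  shows "has_bochner_integral lborel (\<lambda>x. chi_square_density l x * x ^ n)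
           (2 ^ n * pochhammer (real l / 2) n)"
proof (rule has_bochner_integral_nn_integral)
  define s where "s = real l / 2"
  have s: "s > 0"
    using assms by (simp add: s_def)
  let ?c = "2 ^ n / Gamma s"
  have c: "?c \<ge> 0"
    using s by (simp add: Gamma_real_nonneg)
  show "0 \<le> 2 ^ n * pochhammer (real l / 2) n"
    using assms by (simp add: pochhammer_nonneg)
  have eq: "chi_square_density l x * x ^ n =
      ?c * (1 / 2 * (indicator {0..} (x / 2) * (x / 2) powr (s + n - 1) / exp (x / 2)))" if "x \<noteq> 0" for x
  proof (cases "x > 0")
    case True
    have "(x / 2) powr (s + n - 1) = x powr (s - 1) * x ^ n / (2 powr s * 2 ^ n / 2)"
    proof -
      have "x powr (s + n - 1) = x powr (s - 1) * x ^ n"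
        using True by (simp add: powr_add powr_diff powr_realpow)
      moreover have "(2::real) powr (s + n - 1) = 2 powr s * 2 ^ n / 2"
        by (simp add: powr_add powr_diff powr_realpow)
      moreover have "(x / 2) powr (s + n - 1) = x powr (s + n - 1) / 2 powr (s + n - 1)"
        using True by (simp add: powr_divide)
      ultimately show ?thesis
        by (simp only:)
    qed
    then show ?thesis
      using True s Gamma_real_pos[OF s]
      by (simp add: chi_square_density_def exp_minus divide_simps flip: s_def) (auto simp: mult_ac)
  qed (use that in \<open>auto simp: chi_square_density_def\<close>)
  have half: "(0 :: real) \<le> 1 / 2"
    by simp
  have ennreal_eq: "ennreal (chi_square_density l x * x ^ n) =
      ennreal ?c * (ennreal (1 / 2) * ennreal (indicator {0..} (x / 2) * (x / 2) powr (s + n - 1) / exp (x / 2)))"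
    if "x \<noteq> 0" for x
    unfolding eq[OF that] by (simp only: ennreal_mult'[OF c] ennreal_mult'[OF half])
  have "(\<integral>\<^sup>+x. ennreal (chi_square_density l x * x ^ n) \<partial>lborel) =
      (\<integral>\<^sup>+x. ennreal ?c * (ennreal (1 / 2) * ennreal (indicator {0..} (x / 2) * (x / 2) powr (s + n - 1) / exp (x / 2))) \<partial>lborel)"
    by (intro nn_integral_cong_AE eventually_mono[OF AE_lborel_singleton[of 0]] ennreal_eq)
  also have "\<dots> = ennreal ?c * (ennreal (1 / 2) * (\<integral>\<^sup>+x. ennreal (indicator {0..} (0 + 1 / 2 * x) * (0 + 1 / 2 * x) powr (s + n - 1) / exp (0 + 1 / 2 * x)) \<partial>lborel))"
    by (simp add: nn_integral_cmult)
  also have "\<dots> = ennreal ?c * ennreal (Gamma (s + n))"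
    using nn_integral_real_affine[of "\<lambda>x. ennreal (indicator {0..} x * x powr (s + n - 1) / exp x)" "1 / 2" 0] s
    by (simp add: Gamma_conv_nn_integral_real)
  also have "\<dots> = ennreal (?c * Gamma (s + n))"
    by (simp only: ennreal_mult'[OF c])
  also have "?c * Gamma (s + n) = 2 ^ n * pochhammer s n"
    using s by (subst pochhammer_Gamma) (auto elim: nonpos_Ints_cases)
  finally show "(\<integral>\<^sup>+x. ennreal (chi_square_density l x * x ^ n) \<partial>lborel) = ennreal (2 ^ n * pochhammer (real l / 2) n)"
    by (simp add: s_def)
  show "AE x in lborel. 0 \<le> chi_square_density l x * x ^ n"
    by (intro AE_I2 chi_square_density_times_power_nonneg)
qed simp

text \<open>Expanding the exponential gives the moment series, which is the binomial series of
  \<open>(1 - 2 * z) powr (- s)\<close>. The disc \<open>norm (2 * z) < 1\<close> is where it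
  converges absolutely, which permits termwise integration.\<close>

lemma chi_square_laplace_transform:
  fixes z :: complex
  assumes l: "l > 0" and z: "norm (2 * z) < 1"
  shows "has_bochner_integral lborel (\<lambda>x. chi_square_density l x *\<^sub>R exp (z * of_real x))
           ((1 - 2 * z) powr (- of_real (real l / 2)))"
proof -
  define s where "s = real l / 2"
  define g where "g = (\<lambda>n x. of_real (chi_square_density l x * x ^ n) * (z ^ n / fact n))"
  have s: "s > 0"
    using l by (simp add: s_def)
  note moment = has_bochner_integral_chi_square_moment[OF l, folded s_def]
  \<comment> \<open>Generic in the field: the real instance bounds the integrals of the norms, the
    complex one evaluates the transform.\<close>
  have bin: "(- a gchoose n) * (- 2 * y) ^ n = 2 ^ n * pochhammer a n * (y ^ n / fact n)"
    for a y :: "'a :: field_char_0" and n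
  proof -
    have "(- 2 * y) ^ n = ((- 1) * (2 * y)) ^ n"
      by simp
    also have "\<dots> = (- 1) ^ n * (2 ^ n * y ^ n)"
      by (simp only: power_mult_distrib)
    finally have "(- a gchoose n) * (- 2 * y) ^ n =
        ((- 1) ^ n * (- 1) ^ n) * (2 ^ n * pochhammer a n * (y ^ n / fact n))"
      unfolding gbinomial_pochhammer minus_minus by (simp only: times_divide_eq_left times_divide_eq_right mult_ac)
    then show ?thesis
      by (simp only: minus_one_mult_self mult_1_left)
  qed
  have g_int: "has_bochner_integral lborel (g n) (of_real (2 ^ n * pochhammer s n) * (z ^ n / fact n))" for n
    unfolding g_def by (intro has_bochner_integral_mult_left has_bochner_integral_of_real moment)
  have norm_g: "norm (g n x) = chi_square_density l x * x ^ n * (norm z ^ n / fact n)" for n x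
    using chi_square_density_times_power_nonneg[of l x n]
    by (simp add: g_def norm_mult norm_divide norm_power del: of_real_mult of_real_power)
  have norm_g_int: "(\<integral>x. norm (g n x) \<partial>lborel) = 2 ^ n * pochhammer s n * (norm z ^ n / fact n)" for n
    unfolding norm_g using moment by (intro has_bochner_integral_integral_eq has_bochner_integral_mult_left)
  have sum_norm: "summable (\<lambda>n. \<integral>x. norm (g n x) \<partial>lborel)"
    using sums_summable[OF gen_binomial_real[of "- 2 * norm z" "- s"]] z
    unfolding norm_g_int bin by (simp add: norm_mult)
  have g_sums: "(\<lambda>n. g n x) sums (chi_square_density l x *\<^sub>R exp (z * of_real x))" for x
  proof -
    have "(\<lambda>n. chi_square_density l x *\<^sub>R ((z * of_real x) ^ n /\<^sub>R fact n)) sums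
        (chi_square_density l x *\<^sub>R exp (z * of_real x))"
      by (intro sums_scaleR_right exp_converges)
    then show ?thesis
      by (simp add: g_def scaleR_conv_of_real power_mult_distrib divide_inverse mult_ac)
  qed
  have g_summable: "summable (\<lambda>n. norm (g n x))" for x
  proof -
    have "summable (\<lambda>n. chi_square_density l x * ((norm z * x) ^ n /\<^sub>R fact n))"
      by (intro summable_mult sums_summable[OF exp_converges])
    then show ?thesis
      unfolding norm_g by (simp add: power_mult_distrib divide_inverse mult_ac)
  qed
  have int: "integrable lborel (g n)" for n
    using g_int by (rule integrable.intros)
  have AE: "AE x in lborel. summable (\<lambda>n. norm (g n x))"
    using g_summable by simp
  have suminf_g: "(\<Sum>n. g n x) = chi_square_density l x *\<^sub>R exp (z * of_real x)" for x
    using g_sums by (rule sums_unique[symmetric])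
  have "(\<lambda>n. of_real (2 ^ n * pochhammer s n) * (z ^ n / fact n)) sums
      (\<integral>x. chi_square_density l x *\<^sub>R exp (z * of_real x) \<partial>lborel)"
    using sums_integral[OF int AE sum_norm]
    by (simp only: suminf_g has_bochner_integral_integral_eq[OF g_int])
  moreover have "(\<lambda>n. of_real (2 ^ n * pochhammer s n) * (z ^ n / fact n)) sums
      ((1 - 2 * z) powr (- of_real s))"
    using gen_binomial_complex[of "- 2 * z" "- of_real s"] z
    unfolding bin by (simp add: pochhammer_of_real)
  ultimately have "(\<integral>x. chi_square_density l x *\<^sub>R exp (z * of_real x) \<partial>lborel) = (1 - 2 * z) powr (- of_real s)"
    by (rule sums_unique2)
  moreover have "integrable lborel (\<lambda>x. chi_square_density l x *\<^sub>R exp (z * of_real x))"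
    using integrable_suminf[OF int AE sum_norm] by (simp add: suminf_g)
  ultimately show ?thesis
    by (simp add: has_bochner_integral_iff s_def)
qed

text \<open>For \<open>Re w > 0\<close> the imaginary part of \<open>- 2 * Ln w\<close> stays
  strictly between \<open>- pi\<close> and \<open>pi\<close>, so the principal branch gives
  \<open>w ^ l\<close> without a sign ambiguity.\<close>

lemma powr_neg_half_power_inverse_square:
  fixes w :: complex
  assumes "Re w > 0"
  shows "(1 / w\<^sup>2) powr (- of_real (real l / 2)) = w ^ l"
proof -
  have w: "w \<noteq> 0"
    using assms by auto
  have im: "\<bar>Im (Ln w)\<bar> < pi / 2"
    using assms w Re_Ln_pos_lt by auto
  have "exp (- 2 * Ln w) = 1 / w\<^sup>2"
    using w by (simp add: exp_minus exp_double divide_inverse)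
  moreover have "Ln (exp (- 2 * Ln w)) = - 2 * Ln w"
    using im by (intro Ln_exp) auto
  ultimately have "Ln (1 / w\<^sup>2) = - 2 * Ln w"
    by simp
  then have "(1 / w\<^sup>2) powr (- of_real (real l / 2)) = exp (of_nat l * Ln w)"
    using w by (simp add: powr_def)
  also have "\<dots> = w ^ l"
    using w by (simp add: exp_of_nat_mult)
  finally show ?thesis .
qed

lemma chi_square_laplace_transform_power:
  fixes w :: complex
  assumes "l > 0" "Re w > 0" "norm (1 - 1 / w\<^sup>2) < 1"
  shows "has_bochner_integral lborel
           (\<lambda>x. chi_square_density l x *\<^sub>R exp ((1 - 1 / w\<^sup>2) / 2 * of_real x)) (w ^ l)"
proof -
  have eq: "2 * ((1 - 1 / w\<^sup>2) / 2) = 1 - 1 / w\<^sup>2"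
    by simp
  have "1 - (1 - 1 / w\<^sup>2) = 1 / w\<^sup>2"
    by simp
  then show ?thesis
    using chi_square_laplace_transform[OF assms(1), of "(1 - 1 / w\<^sup>2) / 2", unfolded eq, OF assms(3)]
    by (simp only: powr_neg_half_power_inverse_square[OF assms(2)])
qed

text \<open>Indexing by the set identifies all enumerations of the same degrees of freedom, so that
  the hypotheses form a finite class of sets.\<close>

definition uniform_chi_square_mixture :: "nat set \<Rightarrow> real measure" where
  "uniform_chi_square_mixture S =
     density lborel (\<lambda>x. ennreal ((1 / real (card S)) * (\<Sum>j\<in>S. chi_square_density j x)))"

lemma chi_square_mixture_eq_uniform:
  assumes "inj_on l {1..k}"
  shows "chi_square_mixture k l = uniform_chi_square_mixture (l ` {1..k})"
  using assms by (simp add: chi_square_mixture_def uniform_chi_square_mixture_def card_image sum.reindex)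

lemma sets_uniform_chi_square_mixture [simp]: "sets (uniform_chi_square_mixture S) = sets borel"
  by (simp add: uniform_chi_square_mixture_def)

lemma has_bochner_integral_uniform_chi_square_mixture:
  fixes f :: "real \<Rightarrow> 'b::{banach, second_countable_topology}"
  assumes [measurable]: "f \<in> borel_measurable borel"
    and int: "\<And>j. j \<in> S \<Longrightarrow> has_bochner_integral lborel (\<lambda>x. chi_square_density j x *\<^sub>R f x) (I j)"
  shows "has_bochner_integral (uniform_chi_square_mixture S) f ((1 / real (card S)) *\<^sub>R (\<Sum>j\<in>S. I j))"
  unfolding uniform_chi_square_mixture_def
proof (rule has_bochner_integral_density)
  show "has_bochner_integral lborel
      (\<lambda>x. ((1 / real (card S)) * (\<Sum>j\<in>S. chi_square_density j x)) *\<^sub>R f x)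
      ((1 / real (card S)) *\<^sub>R (\<Sum>j\<in>S. I j))"
    unfolding scaleR_scaleR[symmetric] scaleR_sum_left
    by (intro has_bochner_integral_scaleR_right has_bochner_integral_sum int)
  show "AE x in lborel. 0 \<le> (1 / real (card S)) * (\<Sum>j\<in>S. chi_square_density j x)"
    by (intro AE_I2 mult_nonneg_nonneg sum_nonneg chi_square_density_nonneg) auto
qed simp_all

lemma prob_space_uniform_chi_square_mixture:
  assumes "finite S" "S \<noteq> {}" "0 \<notin> S"
  shows "prob_space (uniform_chi_square_mixture S)"
proof -
  have "has_bochner_integral (uniform_chi_square_mixture S) (\<lambda>_. 1 :: real)
      ((1 / real (card S)) *\<^sub>R (\<Sum>j\<in>S. 1))"
  proof (rule has_bochner_integral_uniform_chi_square_mixture)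
    fix j assume "j \<in> S"
    then have "j > 0"
      using assms(3) by (cases j) auto
    from has_bochner_integral_chi_square_moment[OF this, of 0]
    show "has_bochner_integral lborel (\<lambda>x. chi_square_density j x *\<^sub>R 1) (1 :: real)"
      by simp
  qed simp
  then have "has_bochner_integral (uniform_chi_square_mixture S) (\<lambda>_. 1 :: real) 1"
    using assms by simp
  then have "emeasure (uniform_chi_square_mixture S) (space (uniform_chi_square_mixture S)) = 1"
    by (auto simp: has_bochner_integral_iff emeasure_eq_ennreal_measure)
  then show ?thesis
    by (rule prob_spaceI)
qed

section \<open>Learning uniform mixtures\<close>

text \<open>The test is the real part of a rotated exponential \<open>exp (z * x)\<close> with
  \<open>1 - 2 * z = 1 / w^2\<close>. Equal cardinalities give both mixtures the weight
  \<open>1 / k\<close>, so the means differ by exactly \<open>norm D / k\<close>.\<close>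

lemma uniform_chi_square_mixtures_separated:
  fixes S T :: "nat set"
  assumes S: "S \<subseteq> {1..N}" and T: "T \<subseteq> {1..N}" and card: "card S = card T" and ne: "S \<noteq> T"
    and q: "q > 0" "N \<le> q ^ 3"
  obtains f :: "real \<Rightarrow> real" where "f \<in> borel_measurable borel" "\<And>x. \<bar>f x\<bar> \<le> 1"
    and "exp (- (600 * real q)) / real N \<le>
      \<bar>(\<integral>x. f x \<partial>uniform_chi_square_mixture S) - (\<integral>x. f x \<partial>uniform_chi_square_mixture T)\<bar>"
proof -
  have fin: "finite S" "finite T"
    using S T finite_subset by auto
  define k where "k = card S"
  have k: "k > 0" "k \<le> N"
    using card ne fin S card_mono[of "{1..N}" S] unfolding k_def
    by (auto simp: card_gt_0_iff)
  define e :: "nat \<Rightarrow> complex" where "e = (\<lambda>l. of_bool (l \<in> S) - of_bool (l \<in> T))"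
  have e: "e l = 0 \<or> norm (e l) = 1" for l
    by (auto simp: e_def)
  have "\<exists>l\<in>{1..N}. e l \<noteq> 0"
    using ne S T by (force simp: e_def)
  from littlewood_polynomial_large_on_lemniscate[OF e this q]
  obtain w where w: "Re w > 0" "Re (1 / w\<^sup>2) \<ge> 1" "norm (1 - 1 / w\<^sup>2) < 1"
    and big: "exp (- (600 * real q)) \<le> norm (\<Sum>l\<in>{1..N}. e l * w ^ l)" .
  define D where "D = (\<Sum>l\<in>{1..N}. e l * w ^ l)"
  define z where "z = (1 - 1 / w\<^sup>2) / 2"
  have Re_z: "Re z \<le> 0"
    using w(2) by (simp add: z_def)
  \<comment> \<open>Multiplying by \<open>u\<close> turns \<open>D\<close> into \<open>\<bar>D\<bar>\<close>, so a real-valued test loses nothing.\<close>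
  define u where "u = cnj (sgn D)"
  have "D \<noteq> 0"
    using big by (auto simp: D_def)
  then have u: "norm u = 1"
    by (simp add: u_def norm_sgn)
  have "u * D = of_real ((norm D)\<^sup>2) / of_real (norm D)"
    unfolding complex_norm_square by (simp add: u_def sgn_eq)
  then have uD: "u * D = of_real (norm D)"
    using \<open>D \<noteq> 0\<close> by (simp add: power2_eq_square)
  \<comment> \<open>For negative \<open>x\<close> the exponential may exceed 1 in modulus; cutting
    it off there leaves the expectations unchanged, since the densities vanish.\<close>
  define f where "f = (\<lambda>x::real. if x > 0 then Re (u * exp (z * of_real x)) else 0)"
  have f_meas: "f \<in> borel_measurable borel"
    unfolding f_def by measurable
  have f_le: "\<bar>f x\<bar> \<le> 1" for x
  proof (cases "x > 0")
    case True
    have "\<bar>f x\<bar> \<le> norm (u * exp (z * of_real x))"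
      using True abs_Re_le_cmod[of "u * exp (z * of_real x)"] by (simp only: f_def if_True)
    also have "\<dots> = exp (Re z * x)"
      using u by (simp add: norm_mult)
    also have "\<dots> \<le> 1"
      using True Re_z by (simp add: mult_nonpos_nonneg)
    finally show ?thesis .
  qed (simp add: f_def)
  have f_int: "(\<integral>x. f x \<partial>uniform_chi_square_mixture R) = (1 / real k) * Re (u * (\<Sum>l\<in>R. w ^ l))"
    if R: "R \<subseteq> {1..N}" "card R = k" for R
  proof -
    have "has_bochner_integral lborel (\<lambda>x. chi_square_density l x *\<^sub>R f x) (Re (u * w ^ l))" if "l \<in> R" for l
    proof -
      have "l > 0"
        using that R by auto
      from chi_square_laplace_transform_power[OF this w(1,3), folded z_def]
      have "has_bochner_integral lborel
          (\<lambda>x. Re (u * (chi_square_density l x *\<^sub>R exp (z * of_real x)))) (Re (u * w ^ l))"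
        by (intro has_bochner_integral_bounded_linear[OF bounded_linear_Re] has_bochner_integral_mult_right)
      moreover have "Re (u * (chi_square_density l x *\<^sub>R exp (z * of_real x))) = chi_square_density l x *\<^sub>R f x" for x
        by (simp add: f_def chi_square_density_def)
      ultimately show ?thesis
        by (simp only:)
    qed
    from has_bochner_integral_uniform_chi_square_mixture[OF f_meas this] show ?thesis
      using R(2) by (simp add: has_bochner_integral_iff sum_distrib_left)
  qed
  have D_eq: "D = (\<Sum>l\<in>S. w ^ l) - (\<Sum>l\<in>T. w ^ l)"
  proof -
    have restrict: "(\<Sum>l\<in>{1..N}. of_bool (l \<in> R) * w ^ l) = (\<Sum>l\<in>R. w ^ l)" if "R \<subseteq> {1..N}" for R
      using that by (intro sum.mono_neutral_cong_right) auto
    show ?thesis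
      unfolding D_def e_def left_diff_distrib sum_subtractf restrict[OF S] restrict[OF T] ..
  qed
  have "(\<integral>x. f x \<partial>uniform_chi_square_mixture S) - (\<integral>x. f x \<partial>uniform_chi_square_mixture T) =
      (1 / real k) * Re (u * D)"
    using S T card by (simp add: f_int k_def D_eq right_diff_distrib diff_divide_distrib)
  also have "\<dots> = norm D / real k"
    by (simp add: uD)
  finally have "\<bar>(\<integral>x. f x \<partial>uniform_chi_square_mixture S) - (\<integral>x. f x \<partial>uniform_chi_square_mixture T)\<bar> = norm D / real k"
    by simp
  moreover have "exp (- (600 * real q)) / real N \<le> norm D / real k"
    using big k unfolding D_def by (intro frac_le) auto
  ultimately show ?thesis
    using that f_meas f_le by simp
qed

section \<open>Sample size and the final estimator\<close>

text \<open>The separation \<open>exp (- 600 q) / N\<close> is at least \<open>exp (- 1203 y)\<close>, as \<open>q \<le> 2 y\<close> and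
  \<open>N = y ^ 3 \<le> exp (3 y)\<close>; its square costs \<open>2406 y\<close> in the exponent, and the remaining \<open>3 D y\<close> pays
  for the union bound, because \<open>exp (3 D y) \<ge> (D y) ^ 3 \<ge> D N\<close>.\<close>

lemma sample_size_sufficient:
  fixes \<delta> D y :: real and N m q :: nat
  assumes \<delta>: "0 < \<delta>" "\<delta> < 1" and N: "N \<ge> 1" and y: "y \<ge> 1" "y ^ 3 = real N"
    and q: "real q \<le> 2 * y" and D: "D = 8 * (ln (2 / \<delta>) + 3)"
    and m: "real m \<ge> exp ((2406 + 3 * D) * y)"
  shows "2 * (2 ^ N)\<^sup>2 * exp (- (real m * (exp (- (600 * real q)) / real N)\<^sup>2 / 8)) \<le> \<delta>"
proof -
  have ln_pos: "ln (2 / \<delta>) > 0"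
    using \<delta> by (intro ln_gt_zero) (simp add: field_simps)
  have D1: "D \<ge> 1"
    using ln_pos by (simp add: D)
  have "real N \<le> exp (3 * y)"
  proof -
    have "real N = y ^ 3"
      using y by simp
    also have "\<dots> \<le> exp y ^ 3"
      using y(1) exp_ge_add_one_self[of y] by (intro power_mono) linarith+
    finally show ?thesis
      by (simp flip: exp_of_nat_mult)
  qed
  then have "exp (- (1203 * y)) \<le> exp (- (600 * real q)) / real N"
  proof -
    assume *: "real N \<le> exp (3 * y)"
    have "exp (- (1203 * y)) = exp (- (1200 * y)) / exp (3 * y)"
      by (simp flip: exp_diff)
    also have "\<dots> \<le> exp (- (600 * real q)) / real N"
      using * q N by (intro frac_le) auto
    finally show ?thesis .
  qed
  then have eps: "exp (- (1203 * y)) ^ 2 \<le> (exp (- (600 * real q)) / real N)\<^sup>2"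
    by (intro power_mono) auto
  have "D * real N \<le> exp (3 * D * y)"
  proof -
    have "D * real N \<le> D ^ 3 * y ^ 3"
      using D1 y power_increasing[of 1 3 D] by (simp add: mult_right_mono)
    also have "\<dots> = (D * y) ^ 3"
      by (simp add: power_mult_distrib)
    also have "\<dots> \<le> exp (D * y) ^ 3"
    proof (intro power_mono)
      show "D * y \<le> exp (D * y)"
        using exp_ge_add_one_self[of "D * y"] by linarith
    qed (use D1 y in auto)
    finally show ?thesis
      by (simp add: mult.assoc flip: exp_of_nat_mult)
  qed
  also have "exp (3 * D * y) = exp ((2406 + 3 * D) * y) * exp (- (1203 * y)) ^ 2"
    by (simp add: algebra_simps flip: exp_of_nat_mult exp_add)
  also have "\<dots> \<le> real m * (exp (- (600 * real q)) / real N)\<^sup>2"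
    using m eps by (intro mult_mono) auto
  finally have "D * real N / 8 \<le> real m * (exp (- (600 * real q)) / real N)\<^sup>2 / 8"
    by simp
  \<comment> \<open>\<open>D\<close> is chosen for this: \<open>ln (2 / \<delta>)\<close> yields the
    factor \<open>\<delta> / 2\<close>, and \<open>3 * N\<close> outweighs the \<open>4 ^ N\<close>
    pairs of hypotheses.\<close>
  moreover have "ln (2 / \<delta>) + 3 * real N \<le> D * real N / 8"
    using N ln_pos mult_left_mono[of 1 "real N" "ln (2 / \<delta>)"] by (simp add: D distrib_right)
  ultimately have "exp (- (real m * (exp (- (600 * real q)) / real N)\<^sup>2 / 8))
      \<le> exp (- (ln (2 / \<delta>) + 3 * real N))"
    by (simp only: exp_le_cancel_iff neg_le_iff_le)
  also have "\<dots> = exp (- ln (2 / \<delta>)) * exp (- (3 * real N))"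
    by (simp flip: exp_add)
  also have "exp (- ln (2 / \<delta>)) = \<delta> / 2"
    using \<delta> by (simp add: exp_minus)
  also have "exp (- (3 * real N)) = exp (- 3) ^ N"
    by (simp add: mult.commute flip: exp_of_nat_mult)
  finally have *: "exp (- (real m * (exp (- (600 * real q)) / real N)\<^sup>2 / 8)) \<le> \<delta> / 2 * exp (- 3) ^ N" .
  have "2 * (2 ^ N)\<^sup>2 * exp (- (real m * (exp (- (600 * real q)) / real N)\<^sup>2 / 8))
      \<le> 2 * (2 ^ N)\<^sup>2 * (\<delta> / 2 * exp (- 3) ^ N)"
    using * by (intro mult_left_mono) auto
  also have "\<dots> = \<delta> * (4 * exp (- 3)) ^ N"
    by (simp add: power_mult_distrib power2_eq_square flip: power_mult_distrib[of 2 2])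
  also have "\<dots> \<le> \<delta> * 1"
  proof (intro mult_left_mono power_le_one)
    show "4 * exp (- 3) \<le> (1 :: real)"
      using exp_ge_add_one_self[of "3 :: real"] by (simp add: exp_minus field_simps)
  qed (use \<delta> in auto)
  finally show ?thesis
    by simp
qed

lemma uniform_chi_square_mixture_estimator:
  fixes \<delta> :: real and N k m :: nat
  assumes \<delta>: "0 < \<delta>" "\<delta> < 1" and N: "N \<ge> 1" and k: "k \<ge> 1"
    and m: "real m \<ge> exp ((2406 + 24 * (ln (2 / \<delta>) + 3)) * real N powr (1 / 3))"
  obtains A where "set_estimator m A"
    and "\<And>S. S \<subseteq> {1..N} \<Longrightarrow> card S = k \<Longrightarrow>
      measure (iid_samples m (uniform_chi_square_mixture S))
        {x \<in> space (iid_samples m (uniform_chi_square_mixture S)). A x = S} \<ge> 1 - \<delta>"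
proof -
  define y where "y = real N powr (1 / 3)"
  \<comment> \<open>Rounding up ensures \<open>N \<le> q ^ 3\<close>, while \<open>y \<ge> 1\<close>
    keeps \<open>q \<le> 2 * y\<close>.\<close>
  define q where "q = nat \<lceil>y\<rceil>"
  have y: "y \<ge> 1" "y ^ 3 = real N"
    using N by (auto simp: y_def ge_one_powr_ge_zero powr_power)
  have q: "q > 0" "y \<le> real q" "real q \<le> 2 * y"
    unfolding q_def using y(1) by linarith+
  have "real N \<le> real (q ^ 3)"
    using q(2) y power_mono[of y "real q" 3] by simp
  then have Nq: "N \<le> q ^ 3"
    by (simp only: of_nat_le_iff)
  have m_pos: "m > 0"
    using m exp_gt_zero[of "(2406 + 24 * (ln (2 / \<delta>) + 3)) * real N powr (1 / 3)"]
    by (cases m) auto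
  define \<epsilon> where "\<epsilon> = exp (- (600 * real q)) / real N"
  define \<Theta> where "\<Theta> = {S. S \<subseteq> {1..N} \<and> card S = k}"
  have fin: "finite \<Theta>"
    by (rule finite_subset[of _ "Pow {1..N}"]) (auto simp: \<Theta>_def)
  have card_\<Theta>: "card \<Theta> \<le> 2 ^ N"
    using card_mono[of "Pow {1..N}" \<Theta>] by (auto simp: \<Theta>_def card_Pow)
  let ?test = "\<lambda>S T f. f \<in> borel_measurable borel \<and> (\<forall>x. \<bar>f x\<bar> \<le> 1) \<and> (S \<noteq> T \<longrightarrow> \<epsilon> \<le>
    \<bar>(\<integral>x. f x \<partial>uniform_chi_square_mixture S) - (\<integral>x. f x \<partial>uniform_chi_square_mixture T)\<bar>)"
  have "\<exists>f :: real \<Rightarrow> real. ?test S T f" if "S \<in> \<Theta>" "T \<in> \<Theta>" for S T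
  proof (cases "S = T")
    case True
    then show ?thesis
      \<comment> \<open>The estimator consults a test for every pair, so the diagonal gets a trivial
        one.\<close>
      by (intro exI[of _ "\<lambda>_. 0"]) auto
  next
    case False
    with that have "S \<subseteq> {1..N}" "T \<subseteq> {1..N}" "card S = card T" "S \<noteq> T"
      by (auto simp: \<Theta>_def)
    from uniform_chi_square_mixtures_separated[OF this q(1) Nq, folded \<epsilon>_def]
    show ?thesis
      by metis
  qed
  then obtain f :: "nat set \<Rightarrow> nat set \<Rightarrow> real \<Rightarrow> real"
    where f: "\<And>S T. S \<in> \<Theta> \<Longrightarrow> T \<in> \<Theta> \<Longrightarrow> ?test S T (f S T)"
    by metis
  have prob: "prob_space (uniform_chi_square_mixture S)" if "S \<in> \<Theta>" for S
    using that k by (intro prob_space_uniform_chi_square_mixture)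
      (auto simp: \<Theta>_def intro: finite_subset)
  obtain A where A: "A \<in> measurable (PiM {..<m} (\<lambda>_. borel)) (count_space UNIV)"
    and A_prob: "\<And>S. S \<in> \<Theta> \<Longrightarrow> measure (PiM {..<m} (\<lambda>_. uniform_chi_square_mixture S))
        {x \<in> space (PiM {..<m} (\<lambda>_. uniform_chi_square_mixture S)). A x = S}
      \<ge> 1 - 2 * (real (card \<Theta>))\<^sup>2 * exp (- (real m * \<epsilon>\<^sup>2 / 8))"
    by (rule estimator_from_separating_tests[of \<Theta> uniform_chi_square_mixture borel f \<epsilon> m])
      (use fin prob f m_pos in \<open>auto simp: \<epsilon>_def\<close>)
  have "real (card \<Theta>) \<le> 2 ^ N"
    using of_nat_mono[OF card_\<Theta>, where 'a = real] by simp
  then have "2 * (real (card \<Theta>))\<^sup>2 * exp (- (real m * \<epsilon>\<^sup>2 / 8)) \<le> 2 * (2 ^ N)\<^sup>2 * exp (- (real m * \<epsilon>\<^sup>2 / 8))"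
    by (intro mult_right_mono mult_left_mono power_mono) auto
  also have "\<dots> \<le> \<delta>"
    unfolding \<epsilon>_def using m
    by (intro sample_size_sufficient[OF \<delta> N y q(3) refl]) (simp add: y_def)
  finally have failure: "2 * (real (card \<Theta>))\<^sup>2 * exp (- (real m * \<epsilon>\<^sup>2 / 8)) \<le> \<delta>" .
  show ?thesis
  proof (rule that[of A])
    show "set_estimator m A"
      using A by (simp add: set_estimator_def)
    fix S assume "S \<subseteq> {1..N}" "card S = k"
    then have "S \<in> \<Theta>"
      by (simp add: \<Theta>_def)
    from A_prob[OF this] failure
    show "measure (iid_samples m (uniform_chi_square_mixture S))
        {x \<in> space (iid_samples m (uniform_chi_square_mixture S)). A x = S} \<ge> 1 - \<delta>"
      unfolding iid_samples_def by linarith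
  qed
qed

theorem mainTheorem7:
  fixes \<delta> :: real
  assumes "0 < \<delta>" and "\<delta> < 1"
  shows "\<exists>C::real. C > 0 \<and>
    (\<forall>(N::nat) (k::nat) (m::nat).
       N \<ge> 1 \<longrightarrow> k \<ge> 1 \<longrightarrow> real m \<ge> exp (C * real N powr (1 / 3)) \<longrightarrow>
       (\<exists>A. set_estimator m A \<and>
          (\<forall>l :: nat \<Rightarrow> nat. inj_on l {1..k} \<longrightarrow> l ` {1..k} \<subseteq> {1..N} \<longrightarrow>
             measure (iid_samples m (chi_square_mixture k l))
               {x \<in> space (iid_samples m (chi_square_mixture k l)). A x = l ` {1..k}}
             \<ge> 1 - \<delta>)))"
proof (intro exI[of _ "2406 + 24 * (ln (2 / \<delta>) + 3)"] conjI allI impI)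
  have "ln (2 / \<delta>) > 0"
    using assms by (intro ln_gt_zero) (simp add: field_simps)
  then show "2406 + 24 * (ln (2 / \<delta>) + 3) > 0"
    by simp
next
  fix N k m :: nat
  assume "N \<ge> 1" "k \<ge> 1" "real m \<ge> exp ((2406 + 24 * (ln (2 / \<delta>) + 3)) * real N powr (1 / 3))"
  from uniform_chi_square_mixture_estimator[OF assms this]
  obtain A where A: "set_estimator m A"
    and A_prob: "\<And>S. S \<subseteq> {1..N} \<Longrightarrow> card S = k \<Longrightarrow>
      measure (iid_samples m (uniform_chi_square_mixture S))
        {x \<in> space (iid_samples m (uniform_chi_square_mixture S)). A x = S} \<ge> 1 - \<delta>"
    by blast
  show "\<exists>A. set_estimator m A \<and>
      (\<forall>l :: nat \<Rightarrow> nat. inj_on l {1..k} \<longrightarrow> l ` {1..k} \<subseteq> {1..N} \<longrightarrow>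
         measure (iid_samples m (chi_square_mixture k l))
           {x \<in> space (iid_samples m (chi_square_mixture k l)). A x = l ` {1..k}} \<ge> 1 - \<delta>)"
    \<comment> \<open>Injectivity of \<open>l\<close> makes its image a set of size \<open>k\<close>
      with the same mixture.\<close>
    using A A_prob by (intro exI[of _ A]) (simp add: chi_square_mixture_eq_uniform card_image)
qed

end
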